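(* We have $\beta > 0.72195$; that is, there exists a set of positive integers having an asymptotic density greater than $0.72195$ which contains no three-term geometric progression with integer ratio.
   Context: A three-term geometric progression with integer ratio is a triple $(a, ak, ak^2)$ of positive integers with $k \geq 2$ an integer. $\beta$ is the supremum of the asymptotic densities $d(A)$ over all sets $A\subset\mathbb{N}$ that contain no three-term geometric progression with integer ratio and whose asymptotic density $d(A)=\lim_{N\to\infty}|A\cap\{1,\dots,N\}|/N$ exists. *)

theory Defs
  imports Complex_Main
begin

definition has_int_ratio_gp3 :: "nat set \<Rightarrow> bool" where
  "has_int_ratio_gp3 A \<longleftrightarrow>
     (\<exists>a k. a \<ge> 1 \<and> k \<ge> 2 \<and> a \<in> A \<and> a * k \<in> A \<and> a * k ^ 2 \<in> A)"

definition has_asymptotic_density :: "nat set \<Rightarrow> real \<Rightarrow> bool" where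
  "has_asymptotic_density A d \<longleftrightarrow>
     (\<lambda>N. real (card (A \<inter> {1..N})) / real N) \<longlonglongrightarrow> d"

(* The paper's natural numbers start at 1, hence the restriction to {1..}.
   The set below is bounded by 1 and contains 0 (take A empty), so the
   conditionally complete Sup on real is the true supremum. *)
definition \<beta> :: real where
  "\<beta> = Sup {d. \<exists>A\<subseteq>{1..}. \<not> has_int_ratio_gp3 A \<and> has_asymptotic_density A d}"

end

(* A progression x, x k, x k^2 whose terms are products s v with s in S and v in V, where every element
   of S is coprime to every element of V, projects to (possibly constant) progressions in S and in V.
   So products of mutually coprime progression-free sets are progression-free, and for finite S the
   density gets multiplied by the sum of the reciprocals of S. Start from the squarefree numbers coprime
   to the primes up to 31, multiply by {1, p, p^3, p^4} for each prime p from 11 to 31, and finally by an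
   explicit progression-free set of integers composed of 2, 3, 5, 7. The last set is better than the
   greedy one, which yields only 0.71974. *)
theory Submission
  imports Defs "HOL-Computational_Algebra.Squarefree" "HOL-Computational_Algebra.Primes"
begin

section \<open>Progression-free sets and their products\<close>

text \<open>No ratio appears: \<open>x dvd y\<close> and \<open>y * y = x * z\<close> both split
  over coprime factors. Concluding \<open>x = y\<close>, rather than excluding ratios at least 2,
  lets projections that are constant in one factor be recombined.\<close>

definition gp_free :: "nat set \<Rightarrow> bool" where
  "gp_free A \<longleftrightarrow> (\<forall>x\<in>A. \<forall>y\<in>A. \<forall>z\<in>A. x dvd y \<longrightarrow> y * y = x * z \<longrightarrow> x = y)"

lemma gp_free_imp_no_int_ratio_gp3:
  assumes "gp_free A"
  shows "\<not> has_int_ratio_gp3 A"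
proof
  assume "has_int_ratio_gp3 A"
  then obtain a k where ak: "a \<ge> 1" "k \<ge> 2" "a \<in> A" "a * k \<in> A" "a * k ^ 2 \<in> A"
    unfolding has_int_ratio_gp3_def by blast
  have "a dvd a * k" "(a * k) * (a * k) = a * (a * k ^ 2)"
    by (simp_all add: power2_eq_square)
  with ak assms have "a = a * k"
    unfolding gp_free_def by blast
  with ak show False by simp
qed

definition mult_set :: "nat set \<Rightarrow> nat set \<Rightarrow> nat set" where
  "mult_set S V = (\<lambda>(s, v). s * v) ` (S \<times> V)"

text \<open>Here \<open>s\<close> divides \<open>t * w\<close> and is coprime to \<open>w\<close>,
  so it divides \<open>t\<close>; by symmetry \<open>t\<close> divides \<open>s\<close>.\<close>

lemma coprime_mult_eq_cong:
  fixes s t v w :: nat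
  assumes "s * v = t * w" "coprime s w" "coprime t v"
  shows "s = t"
  by (metis assms coprime_dvd_mult_left_iff dvd_antisym dvd_triv_left)

lemma inj_on_coprime_mult:
  fixes S V :: "nat set"
  assumes "\<And>s v. s \<in> S \<Longrightarrow> v \<in> V \<Longrightarrow> coprime s v" "0 \<notin> S"
  shows "inj_on (\<lambda>(s, v). s * v) (S \<times> V)"
proof (rule inj_onI, clarify)
  fix s v t w assume h: "s \<in> S" "v \<in> V" "t \<in> S" "w \<in> V" "s * v = t * w"
  then have "s = t" using assms(1) coprime_mult_eq_cong by blast
  moreover from this h assms(2) have "v = w" by (metis mult_cancel1)
  ultimately show "s = t \<and> v = w" by simp
qed

lemma gp_free_mult_set:
  assumes cop: "\<And>s v. s \<in> S \<Longrightarrow> v \<in> V \<Longrightarrow> coprime s v"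
    and "gp_free S" "gp_free V"
  shows "gp_free (mult_set S V)"
  unfolding gp_free_def
proof (intro ballI impI)
  fix x y z assume xyz: "x \<in> mult_set S V" "y \<in> mult_set S V" "z \<in> mult_set S V"
    and dvd: "x dvd y" and eq: "y * y = x * z"
  obtain s1 v1 where 1: "x = s1 * v1" "s1 \<in> S" "v1 \<in> V" using xyz(1) by (auto simp: mult_set_def)
  obtain s2 v2 where 2: "y = s2 * v2" "s2 \<in> S" "v2 \<in> V" using xyz(2) by (auto simp: mult_set_def)
  obtain s3 v3 where 3: "z = s3 * v3" "s3 \<in> S" "v3 \<in> V" using xyz(3) by (auto simp: mult_set_def)
  have c: "coprime s v" if "s \<in> {s1, s2, s3}" "v \<in> {v1, v2, v3}" for s v
    using that 1 2 3 cop by blast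
  have "s1 dvd s2 * v2" "v1 dvd s2 * v2" using dvd 1 2 by (auto intro: dvd_trans)
  then have d: "s1 dvd s2" "v1 dvd v2"
    using c[of s1 v2] c[of s2 v1]
    by (simp_all add: coprime_dvd_mult_left_iff coprime_dvd_mult_right_iff coprime_commute)
  have e: "(s2 * s2) * (v2 * v2) = (s1 * s3) * (v1 * v3)" using eq 1 2 3 by (simp add: ac_simps)
  have "s2 * s2 = s1 * s3"
    by (rule coprime_mult_eq_cong[OF e]) (use c in auto)
  moreover have "v2 * v2 = v1 * v3"
    by (rule coprime_mult_eq_cong[of _ "s2 * s2" _ "s1 * s3"]) (use c e in \<open>auto simp: coprime_commute mult.commute\<close>)
  ultimately have "s1 = s2" "v1 = v2"
    using d assms(2,3) 1 2 3 unfolding gp_free_def by blast+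
  with 1 2 show "x = y" by simp
qed

text \<open>With ratio \<open>k\<close> the last term is \<open>x * k * k\<close>, so squarefreeness
  forces \<open>k = 1\<close>.\<close>

lemma gp_free_squarefree: "gp_free {n. squarefree n}"
  unfolding gp_free_def
proof (intro ballI impI, clarify)
  fix x y z :: nat assume sf: "squarefree x" "squarefree z" and "x dvd y" and eq: "y * y = x * z"
  then obtain k where k: "y = x * k" by auto
  have "x \<noteq> 0" using sf(1) by (metis not_squarefree_0)
  with eq k have "z = x * (k * k)" by (simp add: ac_simps)
  then have "k ^ 2 dvd z" by (simp add: power2_eq_square)
  with sf(2) have "k dvd 1" by (rule squarefreeD)
  with k show "x = y" by simp
qed

lemma gp_free_subset: "gp_free B \<Longrightarrow> A \<subseteq> B \<Longrightarrow> gp_free A"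
  unfolding gp_free_def by blast

text \<open>Powers of \<open>p\<close> in geometric progression have exponents in arithmetic
  progression, and {0, 1, 3, 4} contains only constant ones.\<close>

lemma gp_free_1_3_4:
  fixes p :: nat
  assumes "p > 1"
  shows "gp_free {1, p, p ^ 3, p ^ 4}"
proof -
  have "{1, p, p ^ 3, p ^ 4} = (\<lambda>i. p ^ i) ` {0, 1, 3, 4}" by auto
  moreover have "gp_free ((\<lambda>i. p ^ i) ` {0, 1, 3, 4})"
    unfolding gp_free_def
  proof (intro ballI impI, elim imageE)
    fix x y z i j k :: nat
    assume ijk: "i \<in> {0, 1, 3, 4}" "j \<in> {0, 1, 3, 4}" "k \<in> {0, 1, 3, 4}"
      and xyz: "x = p ^ i" "y = p ^ j" "z = p ^ k" and "x dvd y" "y * y = x * z"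
    then have "p ^ i dvd p ^ j" "p ^ (j + j) = p ^ (i + k)"
      by (simp_all only: power_add)
    then have "i \<le> j" "j + j = i + k"
      using power_dvd_imp_le[of p i j] power_inject_exp[of p "j + j" "i + k"] assms by simp_all
    with ijk have "i = j" by auto
    with xyz show "x = y" by simp
  qed
  ultimately show ?thesis by simp
qed

section \<open>Asymptotic density\<close>

lemma density_le_one:
  assumes "has_asymptotic_density A d"
  shows "d \<le> 1"
proof (rule LIMSEQ_le_const2[OF assms[unfolded has_asymptotic_density_def]], intro exI allI impI)
  fix N :: nat
  have "card (A \<inter> {1..N}) \<le> card {1..N}" by (rule card_mono) auto
  then have "real (card (A \<inter> {1..N})) \<le> real N" by simp
  then show "real (card (A \<inter> {1..N})) / real N \<le> 1"
    by (cases "N = 0") simp_all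
qed

lemma density_disjoint_union:
  assumes "has_asymptotic_density A a" "has_asymptotic_density B b" "A \<inter> B = {}"
  shows "has_asymptotic_density (A \<union> B) (a + b)"
proof -
  have "card ((A \<union> B) \<inter> {1..N}) = card (A \<inter> {1..N}) + card (B \<inter> {1..N})" for N
    using assms(3) by (subst card_Un_disjoint[symmetric]) (auto intro: arg_cong[where f = card])
  then show ?thesis
    using tendsto_add[OF assms(1,2)[unfolded has_asymptotic_density_def]]
    by (simp add: has_asymptotic_density_def add_divide_distrib)
qed

lemma tendsto_div_ratio:
  fixes t :: nat
  assumes "t > 0"
  shows "(\<lambda>N. real (N div t) / real N) \<longlonglongrightarrow> 1 / real t"
proof (rule real_tendsto_sandwich)
  show "\<forall>\<^sub>F N in sequentially. 1 / real t - 1 / real N \<le> real (N div t) / real N"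
  proof (rule eventually_sequentiallyI[of 1])
    fix N :: nat assume "N \<ge> 1"
    have "real N = real t * real (N div t) + real (N mod t)"
      by (metis mult_div_mod_eq of_nat_add of_nat_mult)
    moreover have "real (N mod t) \<le> real t" using assms by (simp add: less_imp_le)
    ultimately have "real N \<le> real t * (real (N div t) + 1)" by (simp add: algebra_simps)
    then have "real N / real t - 1 \<le> real (N div t)"
      using assms by (simp add: field_simps)
    then have "(real N / real t - 1) / real N \<le> real (N div t) / real N"
      by (rule divide_right_mono) simp
    moreover have "(real N / real t - 1) / real N = 1 / real t - 1 / real N"
      using \<open>N \<ge> 1\<close> by (simp add: diff_divide_distrib)
    ultimately show "1 / real t - 1 / real N \<le> real (N div t) / real N" by simp
  qed
  show "\<forall>\<^sub>F N in sequentially. real (N div t) / real N \<le> 1 / real t"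
  proof (rule eventually_sequentiallyI[of 1])
    fix N :: nat assume "N \<ge> 1"
    have "real (N div t) \<le> real N / real t" by (rule of_nat_div_le_of_nat)
    then show "real (N div t) / real N \<le> 1 / real t"
      using \<open>N \<ge> 1\<close> assms by (simp add: field_simps)
  qed
  show "(\<lambda>N. 1 / real t - 1 / real N) \<longlonglongrightarrow> 1 / real t"
    using tendsto_diff[OF tendsto_const lim_1_over_n] by fastforce
qed simp

text \<open>Elements of the dilate up to \<open>N\<close> correspond to elements of \<open>V\<close>
  up to \<open>N div t\<close>, and \<open>N div t\<close> is asymptotic to
  \<open>N / t\<close>.\<close>

lemma density_dilate:
  fixes t :: nat
  assumes "has_asymptotic_density V d" "t > 0"
  shows "has_asymptotic_density ((\<lambda>v. t * v) ` V) (d / real t)"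
proof -
  have eq: "card ((\<lambda>v. t * v) ` V \<inter> {1..N}) = card (V \<inter> {1..N div t})" for N
  proof -
    have "(\<lambda>v. t * v) ` V \<inter> {1..N} = (\<lambda>v. t * v) ` (V \<inter> {1..N div t})"
      using assms(2) by (auto simp: less_eq_div_iff_mult_less_eq mult.commute)
    moreover have "inj_on (\<lambda>v. t * v) (V \<inter> {1..N div t})"
      using assms(2) by (auto intro: inj_onI)
    ultimately show ?thesis by (simp add: card_image)
  qed
  have "filterlim (\<lambda>N. N div t) at_top sequentially"
    using assms(2) by (simp add: filterlim_at_top_div_const_nat)
  from filterlim_compose[OF assms(1)[unfolded has_asymptotic_density_def] this]
  have "(\<lambda>N. real (card (V \<inter> {1..N div t})) / real (N div t) * (real (N div t) / real N))
      \<longlonglongrightarrow> d * (1 / real t)"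
    by (intro tendsto_mult tendsto_div_ratio assms(2))
  moreover have "real (card (V \<inter> {1..N div t})) / real (N div t) * (real (N div t) / real N)
      = real (card ((\<lambda>v. t * v) ` V \<inter> {1..N})) / real N" for N
    \<comment> \<open>If \<open>N div t = 0\<close>, both sides are 0: the count is empty and
      division by zero yields 0.\<close>
    using eq[of N] by (cases "N div t = 0") auto
  ultimately show ?thesis by (simp only: has_asymptotic_density_def mult_1_right times_divide_eq_right)
qed

text \<open>The product set is a finite union of dilates of \<open>V\<close>, pairwise disjoint by
  injectivity, so their densities add up.\<close>

lemma density_mult_set:
  assumes "finite S" "0 \<notin> S" "has_asymptotic_density V d"
    and "inj_on (\<lambda>(s, v). s * v) (S \<times> V)"
  shows "has_asymptotic_density (mult_set S V) (d * (\<Sum>s\<in>S. 1 / real s))"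
  using assms(1,2,4)
proof (induction S rule: finite_induct)
  case empty
  then show ?case by (simp add: mult_set_def has_asymptotic_density_def)
next
  case (insert s S)
  have eq: "mult_set (insert s S) V = mult_set S V \<union> (\<lambda>v. s * v) ` V"
    by (auto simp: mult_set_def image_iff)
  have "inj_on (\<lambda>(s, v). s * v) (S \<times> V)"
    using insert.prems(2) by (rule inj_on_subset) auto
  with insert have S: "has_asymptotic_density (mult_set S V) (d * (\<Sum>s\<in>S. 1 / real s))" by simp
  have s: "has_asymptotic_density ((\<lambda>v. s * v) ` V) (d / real s)"
    using insert.prems assms(3) by (intro density_dilate) auto
  have "mult_set S V \<inter> (\<lambda>v. s * v) ` V = {}"
  proof (rule ccontr)
    assume "mult_set S V \<inter> (\<lambda>v. s * v) ` V \<noteq> {}"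
    then obtain s' v w where h: "s' \<in> S" "v \<in> V" "w \<in> V" "s' * v = s * w"
      by (auto simp: mult_set_def)
    then have "(s', v) = (s, w)"
      using inj_onD[OF insert.prems(2), of "(s', v)" "(s, w)"] by auto
    with h insert.hyps show False by simp
  qed
  from density_disjoint_union[OF S s this] show ?case
    using insert.hyps by (simp add: eq algebra_simps)
qed

section \<open>Existence of densities by approximation and by periodicity\<close>

text \<open>The relative counts of \<open>A\<close> stay within \<open>e D\<close> of a convergent
  sequence, uniformly in \<open>N\<close>, and are therefore Cauchy. The limit need not be known in
  advance.\<close>

lemma density_exists_by_approximation:
  assumes dens: "\<And>D. has_asymptotic_density (B D) (b D)"
    and approx: "\<And>D N. \<bar>real (card (B D \<inter> {1..N})) - real (card (A \<inter> {1..N}))\<bar> \<le> e D * real N"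
    and e: "e \<longlonglongrightarrow> 0"
  shows "\<exists>a. has_asymptotic_density A a"
proof -
  define r where "r N = real (card (A \<inter> {1..N})) / real N" for N
  define q where "q D N = real (card (B D \<inter> {1..N})) / real N" for D N
  have close: "\<bar>q D N - r N\<bar> \<le> e D" if "N > 0" for D N
  proof -
    have "q D N - r N = (real (card (B D \<inter> {1..N})) - real (card (A \<inter> {1..N}))) / real N"
      by (simp add: q_def r_def diff_divide_distrib)
    then show ?thesis using approx[of D N] that by (simp add: abs_divide divide_le_eq)
  qed
  have "Cauchy r"
  proof (rule CauchyI)
    fix \<epsilon> :: real assume "\<epsilon> > 0"
    then obtain D where "\<bar>e D\<bar> < \<epsilon> / 4"
      using LIMSEQ_D[OF e, of "\<epsilon> / 4"] by auto
    then have D: "e D < \<epsilon> / 4" by simp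
    have "q D \<longlonglongrightarrow> b D" using dens by (simp add: has_asymptotic_density_def q_def[abs_def])
    then obtain M where M: "\<And>m n. m \<ge> M \<Longrightarrow> n \<ge> M \<Longrightarrow> norm (q D m - q D n) < \<epsilon> / 4"
      using CauchyD[OF LIMSEQ_imp_Cauchy, of "q D" "b D" "\<epsilon> / 4"] \<open>\<epsilon> > 0\<close> by force
    have "norm (r m - r n) < \<epsilon>" if "m \<ge> Suc M" "n \<ge> Suc M" for m n
    proof -
      have "\<bar>q D m - r m\<bar> \<le> e D" "\<bar>q D n - r n\<bar> \<le> e D" "\<bar>q D m - q D n\<bar> < \<epsilon> / 4"
        using close[of m D] close[of n D] M[of m n] that by auto
      with D \<open>\<epsilon> > 0\<close> show ?thesis unfolding real_norm_def by linarith
    qed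
    then show "\<exists>M. \<forall>m\<ge>M. \<forall>n\<ge>M. norm (r m - r n) < \<epsilon>" by blast
  qed
  then obtain a where "r \<longlonglongrightarrow> a" using Cauchy_convergent convergent_def by blast
  then show ?thesis by (auto simp: has_asymptotic_density_def r_def[abs_def])
qed

text \<open>Each full period adds the same number \<open>c\<close> of elements, so the count up to
  \<open>N\<close> is \<open>c * (N div m)\<close> up to an error of at most
  \<open>m\<close>.\<close>

lemma density_periodic:
  fixes m :: nat
  assumes "m > 0" and per: "\<And>n. n + m \<in> A \<longleftrightarrow> n \<in> A"
  shows "\<exists>a. has_asymptotic_density A a"
proof -
  define f where "f N = card (A \<inter> {1..N})" for N
  define c where "c = f m"
  have shift: "f (N + m) = f N + c" for N
  proof -
    have eq: "A \<inter> {1..N + m} = (A \<inter> {1..m}) \<union> (\<lambda>n. n + m) ` (A \<inter> {1..N})" (is "?L = ?R")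
    proof (intro subset_antisym subsetI)
      fix n assume n: "n \<in> ?L"
      show "n \<in> ?R"
      proof (cases "n \<le> m")
        case False
        then have "n - m \<in> A \<inter> {1..N}" using n per[of "n - m"] by auto
        moreover have "n = (n - m) + m" using False by simp
        ultimately show ?thesis by blast
      qed (use n in auto)
    qed (auto simp: per)
    have "f (N + m) = card (A \<inter> {1..m}) + card ((\<lambda>n. n + m) ` (A \<inter> {1..N}))"
      unfolding f_def eq by (rule card_Un_disjoint) auto
    also have "card ((\<lambda>n. n + m) ` (A \<inter> {1..N})) = card (A \<inter> {1..N})"
      by (rule card_image) (simp add: inj_on_def)
    finally show ?thesis by (simp add: f_def c_def)
  qed
  have mult: "f (q * m + s) = q * c + f s" for q s
  proof (induction q)
    case (Suc q)
    have "f (Suc q * m + s) = f (q * m + s + m)" by (simp add: ac_simps)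
    also have "\<dots> = Suc q * c + f s" by (simp add: shift Suc)
    finally show ?case .
  qed simp
  have bound: "f s \<le> s" for s
    unfolding f_def using card_mono[of "{1..s}" "A \<inter> {1..s}"] by simp
  have "\<bar>real (f N) - real c * real (N div m)\<bar> \<le> real m" for N
  proof -
    have "f N = (N div m) * c + f (N mod m)" using mult[of "N div m" "N mod m"] by simp
    moreover have "f (N mod m) \<le> m" using bound[of "N mod m"] mod_less_divisor[OF assms(1), of N] by linarith
    ultimately show ?thesis by simp
  qed
  then have "\<bar>real (f N) - real c * real (N div m)\<bar> / real N \<le> real m / real N" for N
    by (intro divide_right_mono) auto
  then have le: "\<bar>real (f N) / real N - real c * (real (N div m) / real N)\<bar> \<le> real m * (1 / real N)" for N
    by (simp add: abs_divide flip: diff_divide_distrib)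
  have "(\<lambda>N. real m * (1 / real N)) \<longlonglongrightarrow> 0"
    using tendsto_mult[OF tendsto_const lim_1_over_n] by fastforce
  then have "(\<lambda>N. real (f N) / real N - real c * (real (N div m) / real N)) \<longlonglongrightarrow> 0"
  proof (rule tendsto_0_le[where K = 1], intro always_eventually allI)
    fix N
    show "norm (real (f N) / real N - real c * (real (N div m) / real N)) \<le> norm (real m * (1 / real N)) * 1"
      unfolding real_norm_def mult_1_right using le by (rule order_trans) (rule abs_ge_self)
  qed
  moreover have "(\<lambda>N. real c * (real (N div m) / real N)) \<longlonglongrightarrow> real c * (1 / real m)"
    by (intro tendsto_mult tendsto_const tendsto_div_ratio assms(1))
  ultimately have "(\<lambda>N. real (f N) / real N) \<longlonglongrightarrow> 0 + real c * (1 / real m)"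
    using tendsto_add by fastforce
  then show ?thesis by (auto simp: has_asymptotic_density_def f_def)
qed

section \<open>Squarefree numbers coprime to a modulus\<close>

lemma sum_inverse_squares_tail:
  assumes "D \<ge> 1"
  shows "(\<Sum>d\<in>{D<..N}. 1 / (real d)\<^sup>2) \<le> 1 / real D"
proof (cases "N \<ge> D")
  case True
  \<comment> \<open>Subtracting \<open>1 / real N\<close> makes the bound inductive: the terms are
    dominated by a telescoping sum.\<close>
  have "(\<Sum>d\<in>{D<..N}. 1 / (real d)\<^sup>2) \<le> 1 / real D - 1 / real N"
    using True
  proof (induction N rule: dec_induct)
    case (step n)
    have "{D<..Suc n} = insert (Suc n) {D<..n}" using step by auto
    then have "(\<Sum>d\<in>{D<..Suc n}. 1 / (real d)\<^sup>2) =
        1 / (real (Suc n))\<^sup>2 + (\<Sum>d\<in>{D<..n}. 1 / (real d)\<^sup>2)" by simp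
    also have "1 / (real (Suc n))\<^sup>2 \<le> 1 / (real n * real (Suc n))"
      using step assms by (intro divide_left_mono) (auto simp: power2_eq_square)
    also have "1 / (real n * real (Suc n)) = 1 / real n - 1 / real (Suc n)"
      using step assms by (simp add: field_simps)
    finally show ?case using step.IH by linarith
  qed simp
  also have "\<dots> \<le> 1 / real D" by simp
  finally show ?thesis .
qed (use assms in simp)

text \<open>At most \<open>N / d^2\<close> numbers up to \<open>N\<close> are multiples of
  \<open>d^2\<close>; summing over \<open>d > D\<close> bounds the error of ignoring large square
  divisors, uniformly in \<open>N\<close>.\<close>

lemma card_square_multiples:
  assumes "D \<ge> 1"
  shows "real (card {n \<in> {1..N}. \<exists>d>D. d\<^sup>2 dvd n}) \<le> real N / real D"
proof -
  have sub: "{n \<in> {1..N}. \<exists>d>D. d\<^sup>2 dvd n} \<subseteq> (\<Union>d\<in>{D<..N}. {n \<in> {1..N}. d\<^sup>2 dvd n})"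
  proof (intro subsetI, elim CollectE conjE exE)
    fix n d assume n: "n \<in> {1..N}" and d: "d > D" "d\<^sup>2 dvd n"
    have "d \<le> d\<^sup>2" by (simp add: power2_eq_square)
    also have "d\<^sup>2 \<le> N" using dvd_imp_le[OF d(2)] n by auto
    finally have "d \<in> {D<..N}" using d by simp
    with n d show "n \<in> (\<Union>d\<in>{D<..N}. {n \<in> {1..N}. d\<^sup>2 dvd n})" by blast
  qed
  have mult: "real (card {n \<in> {1..N}. d\<^sup>2 dvd n}) \<le> real N * (1 / (real d)\<^sup>2)" if "d > 0" for d
  proof -
    have "{n \<in> {1..N}. d\<^sup>2 dvd n} \<subseteq> (\<lambda>k. d\<^sup>2 * k) ` {1..N div d\<^sup>2}"
    proof (intro subsetI, elim CollectE conjE dvdE)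
      fix n k assume "n \<in> {1..N}" "n = d\<^sup>2 * k"
      moreover from this have "k \<in> {1..N div d\<^sup>2}"
        using that by (cases "k = 0") (auto simp: less_eq_div_iff_mult_less_eq mult.commute)
      ultimately show "n \<in> (\<lambda>k. d\<^sup>2 * k) ` {1..N div d\<^sup>2}" by blast
    qed
    from surj_card_le[OF _ this] have "card {n \<in> {1..N}. d\<^sup>2 dvd n} \<le> N div d\<^sup>2" by simp
    then have "real (card {n \<in> {1..N}. d\<^sup>2 dvd n}) \<le> real (N div d\<^sup>2)" by simp
    also have "\<dots> \<le> real N / real (d\<^sup>2)" by (rule of_nat_div_le_of_nat)
    finally show ?thesis by simp
  qed
  have "real (card {n \<in> {1..N}. \<exists>d>D. d\<^sup>2 dvd n})
      \<le> real (card (\<Union>d\<in>{D<..N}. {n \<in> {1..N}. d\<^sup>2 dvd n}))"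
    by (intro of_nat_mono card_mono sub) simp
  also have "\<dots> \<le> (\<Sum>d\<in>{D<..N}. real (card {n \<in> {1..N}. d\<^sup>2 dvd n}))"
    unfolding of_nat_sum[symmetric] by (intro of_nat_mono card_UN_le) simp
  also have "\<dots> \<le> (\<Sum>d\<in>{D<..N}. real N * (1 / (real d)\<^sup>2))"
    by (intro sum_mono mult) auto
  also have "\<dots> = real N * (\<Sum>d\<in>{D<..N}. 1 / (real d)\<^sup>2)"
    by (rule sum_distrib_left[symmetric])
  also have "\<dots> \<le> real N * (1 / real D)"
    by (intro mult_left_mono sum_inverse_squares_tail assms) simp
  finally show ?thesis by simp
qed

definition sqfree_coprime :: "nat \<Rightarrow> nat set" where
  "sqfree_coprime Q = {n. squarefree n \<and> coprime n Q}"

text \<open>For fixed \<open>D\<close>, sieving only by the squares of \<open>2, \<dots>, D + 1\<close> leaves a periodic set.\<close>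

lemma density_sqfree_coprime_exists:
  assumes "Q > 0"
  shows "\<exists>a. has_asymptotic_density (sqfree_coprime Q) a"
proof -
  define B where "B D = {n. coprime n Q \<and> (\<forall>d\<in>{2..Suc D}. \<not> d\<^sup>2 dvd n)}" for D
  have "\<exists>b. has_asymptotic_density (B D) b" for D
  proof (rule density_periodic)
    \<comment> \<open>A common multiple of \<open>Q\<close> and all the sieving squares is a
      period.\<close>
    let ?m = "Q * (\<Prod>d\<in>{2..Suc D}. d\<^sup>2)"
    show "?m > 0" using assms by (auto intro!: prod_pos)
    fix n
    have "coprime (n + ?m) Q \<longleftrightarrow> coprime n Q"
      using gcd_add_mult[of Q "\<Prod>d\<in>{2..Suc D}. d\<^sup>2" n]
      unfolding coprime_iff_gcd_eq_1 gcd.commute[of _ Q] by (simp only: add.commute mult.commute)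
    moreover have "d\<^sup>2 dvd n + ?m \<longleftrightarrow> d\<^sup>2 dvd n" if "d \<in> {2..Suc D}" for d
    proof -
      have "d\<^sup>2 dvd ?m" using that by (intro dvd_mult dvd_prodI) auto
      then show ?thesis by (rule dvd_add_left_iff)
    qed
    ultimately show "n + ?m \<in> B D \<longleftrightarrow> n \<in> B D" by (simp add: B_def)
  qed
  then obtain b where b: "\<And>D. has_asymptotic_density (B D) (b D)" by metis
  show ?thesis
  proof (rule density_exists_by_approximation[OF b])
    show "(\<lambda>D. 1 / real (Suc D)) \<longlonglongrightarrow> 0" by (rule LIMSEQ_Suc[OF lim_1_over_n])
    fix D N
    have "squarefree n \<Longrightarrow> d \<ge> 2 \<Longrightarrow> \<not> d\<^sup>2 dvd n" for n d :: nat
      using squarefreeD[of n d] by auto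
    then have 1: "sqfree_coprime Q \<inter> {1..N} \<subseteq> B D \<inter> {1..N}"
      unfolding sqfree_coprime_def B_def by fastforce
    \<comment> \<open>A number that survives the sieve without being squarefree has a square divisor
      beyond the sieving range.\<close>
    have 2: "B D \<inter> {1..N} \<subseteq> (sqfree_coprime Q \<inter> {1..N}) \<union> {n \<in> {1..N}. \<exists>d>Suc D. d\<^sup>2 dvd n}"
    proof
      fix n assume n: "n \<in> B D \<inter> {1..N}"
      show "n \<in> (sqfree_coprime Q \<inter> {1..N}) \<union> {n \<in> {1..N}. \<exists>d>Suc D. d\<^sup>2 dvd n}"
      proof (cases "squarefree n")
        case False
        then obtain d where d: "d\<^sup>2 dvd n" "\<not> d dvd 1" by (auto simp: squarefree_def)
        have "d \<noteq> 0" using d(1) n by (intro notI) simp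
        moreover have "d \<noteq> 1" using d(2) by simp
        ultimately have "d \<ge> 2" by linarith
        moreover have "d \<notin> {2..Suc D}" using d(1) n unfolding B_def by blast
        ultimately have "d > Suc D" by simp
        with d(1) n show ?thesis by blast
      qed (use n in \<open>auto simp: sqfree_coprime_def B_def\<close>)
    qed
    have abs_diff_le: "\<bar>real b - real a\<bar> \<le> x" if "a \<le> b" "b \<le> a + c" "real c \<le> x"
      for a b c :: nat and x
      using that by linarith
    show "\<bar>real (card (B D \<inter> {1..N})) - real (card (sqfree_coprime Q \<inter> {1..N}))\<bar>
        \<le> 1 / real (Suc D) * real N"
    proof (rule abs_diff_le)
      show "card (sqfree_coprime Q \<inter> {1..N}) \<le> card (B D \<inter> {1..N})"
        by (rule card_mono[OF _ 1]) simp
      show "card (B D \<inter> {1..N})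
          \<le> card (sqfree_coprime Q \<inter> {1..N}) + card {n \<in> {1..N}. \<exists>d>Suc D. d\<^sup>2 dvd n}"
        by (rule order_trans[OF card_mono[OF _ 2] card_Un_le]) simp
      have "real N / real (Suc D) = 1 / real (Suc D) * real N" by simp
      with card_square_multiples[of "Suc D" N, OF Suc_leI[OF zero_less_Suc, folded One_nat_def]]
      show "real (card {n \<in> {1..N}. \<exists>d>Suc D. d\<^sup>2 dvd n}) \<le> 1 / real (Suc D) * real N"
        by (simp only:)
    qed
  qed
qed

section \<open>Lower bound for the density of the squarefree numbers\<close>

text \<open>The square part is a multiple \<open>d * t\<close> of \<open>d\<close>, and cancelling
  leaves \<open>t^2\<close> dividing the squarefree \<open>m\<close>. This makes the decomposition
  into a square and a squarefree number unique.\<close>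

lemma square_part_square_times_squarefree:
  fixes d m :: nat
  assumes "squarefree m" "d > 0"
  shows "square_part (d\<^sup>2 * m) = d"
proof -
  define e where "e = square_part (d\<^sup>2 * m)"
  have "d dvd e" unfolding e_def dvd_square_part_iff by simp
  then obtain t where t: "e = d * t" by auto
  have "e\<^sup>2 dvd d\<^sup>2 * m" unfolding e_def by (rule square_part_square_dvd)
  then have "t\<^sup>2 dvd m" using assms(2) by (simp add: t power_mult_distrib)
  with assms(1) have "t dvd 1" by (rule squarefreeD)
  with t show ?thesis by (simp add: e_def)
qed

text \<open>The constant is a rational upper bound for \<open>\<zeta>(2)\<close>; adding \<open>1 / (D + 1/2)\<close> makes the partial sums
  decreasing.\<close>

lemma sum_inverse_squares_le:
  assumes "D \<ge> 20"
  shows "(\<Sum>d\<in>{1..D}. 1 / (real d)\<^sup>2) \<le> 1.64495"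
proof -
  have "(\<Sum>d\<in>{1..D}. 1 / (real d)\<^sup>2) + 1 / (real D + 1 / 2) \<le> 1.64495"
    using assms
  proof (induction D rule: dec_induct)
    case base
    show ?case by (simp add: sum.atLeast1_atMost_eq lessThan_nat_numeral lessThan_Suc)
  next
    case (step n)
    \<comment> \<open>The product on the right is (n + 1)^2 - 1/4, and its reciprocal
      telescopes.\<close>
    have "1 / (real (Suc n))\<^sup>2 \<le> 1 / ((real n + 1 / 2) * (real (Suc n) + 1 / 2))"
      by (intro divide_left_mono) (simp_all add: power2_eq_square algebra_simps add_pos_nonneg)
    also have "\<dots> = 1 / (real n + 1 / 2) - 1 / (real (Suc n) + 1 / 2)"
      by (simp add: divide_simps)
    finally show ?case using step.IH by simp
  qed
  moreover have "1 / (real D + 1 / 2) \<ge> 0" by simp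
  ultimately show ?thesis by linarith
qed

text \<open>Every positive integer is uniquely a square times a squarefree number, which gives
  \<open>1 \<le> a \<zeta>(2)\<close>.\<close>

lemma density_squarefree_ge:
  assumes "has_asymptotic_density {n. squarefree n} a"
  shows "a \<ge> 1 / 1.64495"
proof -
  \<comment> \<open>The positive integers whose square part is at most \<open>D\<close>; those left
    out have a square divisor exceeding \<open>D^2\<close>, so they make up at most a fraction
    \<open>1 / D\<close> of {1..N}.\<close>
  define W where "W D = mult_set ((\<lambda>d. d\<^sup>2) ` {1..D}) {n. squarefree n}" for D
  have W: "has_asymptotic_density (W D) (a * (\<Sum>d\<in>{1..D}. 1 / (real d)\<^sup>2))" for D
  proof -
    have "inj_on (\<lambda>(s, v). s * v) ((\<lambda>d. d\<^sup>2) ` {1..D} \<times> {n. squarefree n})"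
    proof (rule inj_onI, clarsimp)
      fix d m e l :: nat
      assume h: "Suc 0 \<le> d" "Suc 0 \<le> e" "squarefree m" "squarefree l" "d\<^sup>2 * m = e\<^sup>2 * l"
      then have "d = e"
        using square_part_square_times_squarefree[of m d] square_part_square_times_squarefree[of l e] by simp
      with h show "d = e \<and> m = l" by simp
    qed
    then have "has_asymptotic_density (W D) (a * (\<Sum>s\<in>(\<lambda>d. d\<^sup>2) ` {1..D}. 1 / real s))"
      unfolding W_def using assms by (intro density_mult_set) auto
    also have "(\<Sum>s\<in>(\<lambda>d. d\<^sup>2) ` {1..D}. 1 / real s) = (\<Sum>d\<in>{1..D}. 1 / (real d)\<^sup>2)"
      by (subst sum.reindex) (auto simp: inj_on_def)
    finally show ?thesis .
  qed
  have bound: "1 - 1 / real D \<le> a * (\<Sum>d\<in>{1..D}. 1 / (real d)\<^sup>2)" if "D \<ge> 1" for D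
  proof (rule LIMSEQ_le_const[OF W[unfolded has_asymptotic_density_def]], intro exI allI impI)
    fix N :: nat assume "N \<ge> 1"
    have "{1..N} \<subseteq> (W D \<inter> {1..N}) \<union> {n \<in> {1..N}. \<exists>d>D. d\<^sup>2 dvd n}"
    proof
      fix n assume n: "n \<in> {1..N}"
      have "square_part n > 0" using n by (simp add: zero_less_iff_neq_zero)
      show "n \<in> (W D \<inter> {1..N}) \<union> {n \<in> {1..N}. \<exists>d>D. d\<^sup>2 dvd n}"
      proof (cases "square_part n \<le> D")
        case True
        have "((square_part n)\<^sup>2, squarefree_part n) \<in> (\<lambda>d. d\<^sup>2) ` {1..D} \<times> {n. squarefree n}"
          using True \<open>square_part n > 0\<close> by auto
        moreover have "n = (square_part n)\<^sup>2 * squarefree_part n"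
          using squarefree_decompose[of n] by (simp only: mult.commute)
        ultimately have "n \<in> W D" unfolding W_def mult_set_def by (force simp only: image_iff split_conv)
        with n show ?thesis by blast
      next
        case False
        then have "square_part n > D" by simp
        moreover have "(square_part n)\<^sup>2 dvd n" by (rule square_part_square_dvd)
        ultimately show ?thesis using n by blast
      qed
    qed
    then have "card {1..N} \<le> card (W D \<inter> {1..N}) + card {n \<in> {1..N}. \<exists>d>D. d\<^sup>2 dvd n}"
      by (intro order_trans[OF card_mono card_Un_le]) simp_all
    then have "real (card {1..N}) \<le> real (card (W D \<inter> {1..N}) + card {n \<in> {1..N}. \<exists>d>D. d\<^sup>2 dvd n})"
      by (rule of_nat_mono)
    also have "\<dots> \<le> real (card (W D \<inter> {1..N})) + real N / real D"
      unfolding of_nat_add using card_square_multiples[OF that, of N] by (rule add_left_mono)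
    finally have "real N - real N / real D \<le> real (card (W D \<inter> {1..N}))"
      by (simp add: algebra_simps)
    then have "(real N - real N / real D) / real N \<le> real (card (W D \<inter> {1..N})) / real N"
      by (rule divide_right_mono) simp
    moreover have "(real N - real N / real D) / real N = 1 - 1 / real D"
      using \<open>N \<ge> 1\<close> by (simp add: diff_divide_distrib)
    ultimately show "1 - 1 / real D \<le> real (card (W D \<inter> {1..N})) / real N" by simp
  qed
  have "a \<ge> 0"
    by (rule LIMSEQ_le_const[OF assms[unfolded has_asymptotic_density_def]]) simp
  have "1 - 1 / real D \<le> a * 1.64495" if "D \<ge> 20" for D
    using bound[of D] mult_left_mono[OF sum_inverse_squares_le[OF that] \<open>a \<ge> 0\<close>] that by linarith
  moreover have "(\<lambda>D. 1 - 1 / real D) \<longlonglongrightarrow> 1 - 0"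
    by (intro tendsto_diff tendsto_const lim_1_over_n)
  ultimately have "1 - 0 \<le> a * 1.64495"
    by (intro LIMSEQ_le_const2[of "\<lambda>D. 1 - 1 / real D"]) blast+
  then show ?thesis by (simp add: field_simps)
qed

section \<open>Changing the exponents allowed at single primes\<close>

text \<open>A squarefree number contains \<open>p\<close> at most once; removing that factor leaves
  a number coprime to \<open>p\<close>.\<close>

lemma sqfree_coprime_eq_mult_set:
  assumes "prime p" "\<not> p dvd Q"
  shows "sqfree_coprime Q = mult_set {1, p} (sqfree_coprime (Q * p))"
proof (intro subset_antisym subsetI)
  fix n assume "n \<in> sqfree_coprime Q"
  then have n: "squarefree n" "coprime n Q" by (auto simp: sqfree_coprime_def)
  show "n \<in> mult_set {1, p} (sqfree_coprime (Q * p))"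
  proof (cases "p dvd n")
    case True
    then obtain m where m: "n = p * m" by auto
    have "\<not> p dvd m"
    proof
      assume "p dvd m"
      then have "p\<^sup>2 dvd n" by (simp add: m power2_eq_square)
      with n(1) have "p dvd 1" by (rule squarefreeD)
      with assms(1) show False by simp
    qed
    then have "coprime m p" using assms(1) prime_imp_coprime coprime_commute by blast
    moreover have "squarefree m" "coprime m Q"
      using n squarefree_multD(2) by (auto simp: m coprime_mult_left_iff)
    ultimately have "m \<in> sqfree_coprime (Q * p)" by (simp add: sqfree_coprime_def)
    with m show ?thesis by (auto simp: mult_set_def)
  next
    case False
    then have "coprime n p" using assms(1) prime_imp_coprime coprime_commute by blast
    with n have "n \<in> sqfree_coprime (Q * p)" by (simp add: sqfree_coprime_def)
    then show ?thesis by (force simp: mult_set_def)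
  qed
next
  fix n assume "n \<in> mult_set {1, p} (sqfree_coprime (Q * p))"
  then obtain s m where m: "n = s * m" "s \<in> {1, p}" "squarefree m" "coprime m Q" "coprime m p"
    by (auto simp: mult_set_def sqfree_coprime_def)
  have "squarefree s" "coprime s m" "coprime s Q"
    using m(2,5) squarefree_prime[OF assms(1)] prime_imp_coprime[OF assms] by (auto simp: coprime_commute)
  with m show "n \<in> sqfree_coprime Q"
    by (simp add: sqfree_coprime_def squarefree_mult_coprime)
qed

text \<open>The decomposition by {1, p} gives density(Q) = density(Q p) (1 + 1/p). Since both
  densities are already known to exist, uniqueness of limits allows solving for the one at
  \<open>Q * p\<close>.\<close>

lemma density_sqfree_coprime_prod_primes:
  assumes "finite S" "\<And>p. p \<in> S \<Longrightarrow> prime p"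
  shows "\<exists>d \<ge> 1 / 1.64495 * (\<Prod>p\<in>S. real p / (real p + 1)).
    has_asymptotic_density (sqfree_coprime (\<Prod>S)) d"
  using assms
proof (induction S rule: finite_induct)
  case empty
  obtain a where a: "has_asymptotic_density (sqfree_coprime 1) a"
    using density_sqfree_coprime_exists[of 1] by auto
  then have "a \<ge> 1 / 1.64495" by (intro density_squarefree_ge) (simp add: sqfree_coprime_def)
  with a show ?case by auto
next
  case (insert p S)
  define Q where "Q = \<Prod>S"
  have p: "prime p" using insert.prems by simp
  have "\<not> p dvd Q"
  proof
    assume "p dvd Q"
    then obtain q where "q \<in> S" "p dvd q"
      using prime_dvd_prod_iff[OF insert.hyps(1) p, of "\<lambda>q. q"] by (auto simp: Q_def)
    with insert p show False using primes_dvd_imp_eq by blast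
  qed
  have "Q > 0" unfolding Q_def using insert.prems by (intro prod_pos) (auto simp: prime_gt_0_nat)
  with p have "Q * p > 0" by (simp add: prime_gt_0_nat)
  then obtain b where b: "has_asymptotic_density (sqfree_coprime (Q * p)) b"
    using density_sqfree_coprime_exists by blast
  have "inj_on (\<lambda>(s, v). s * v) ({1, p} \<times> sqfree_coprime (Q * p))"
    using p by (intro inj_on_coprime_mult) (auto simp: sqfree_coprime_def coprime_commute)
  from density_mult_set[OF _ _ b this]
  have "has_asymptotic_density (sqfree_coprime Q) (b * (\<Sum>s\<in>{1, p}. 1 / real s))"
    using p by (auto simp: sqfree_coprime_eq_mult_set[OF p \<open>\<not> p dvd Q\<close>])
  moreover obtain d where d: "d \<ge> 1 / 1.64495 * (\<Prod>p\<in>S. real p / (real p + 1))"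
      "has_asymptotic_density (sqfree_coprime Q) d"
    using insert Q_def by auto
  ultimately have "d = b * (\<Sum>s\<in>{1, p}. 1 / real s)"
    unfolding has_asymptotic_density_def using LIMSEQ_unique by blast
  also have "\<dots> = b * ((real p + 1) / real p)"
    using prime_gt_1_nat[OF p] by (simp add: field_simps)
  finally have "b = real p / (real p + 1) * d"
    using prime_gt_1_nat[OF p] by (simp add: field_simps)
  then have "b \<ge> real p / (real p + 1) * (1 / 1.64495 * (\<Prod>p\<in>S. real p / (real p + 1)))"
    using d(1) by (simp only: mult_left_mono divide_nonneg_nonneg of_nat_0_le_iff add_nonneg_nonneg zero_le_one)
  with b insert.hyps show ?case by (auto simp: Q_def ac_simps)
qed

text \<open>\<open>S\<close> holds the primes to be avoided, \<open>P\<close> those allowed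
  exponents 0, 1, 3, 4. The induction varies \<open>S\<close>: a prime \<open>p\<close> of
  \<open>P\<close> is first moved to \<open>S\<close>, and the set obtained is multiplied by {1, p,
  p^3, p^4}.\<close>

lemma density_gp_free_coprime:
  assumes "finite P" "finite S" "S \<inter> P = {}" "\<And>p. p \<in> S \<union> P \<Longrightarrow> prime p"
  shows "\<exists>V. \<exists>d \<ge> 1 / 1.64495 * (\<Prod>p\<in>S. real p / (real p + 1)) * (\<Prod>p\<in>P. 1 + 1 / real p ^ 3).
    has_asymptotic_density V d \<and> gp_free V \<and> (\<forall>v\<in>V. v > 0 \<and> coprime v (\<Prod>S))"
  using assms
proof (induction P arbitrary: S rule: finite_induct)
  case empty
  then obtain d where "d \<ge> 1 / 1.64495 * (\<Prod>p\<in>S. real p / (real p + 1))"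
      "has_asymptotic_density (sqfree_coprime (\<Prod>S)) d"
    using density_sqfree_coprime_prod_primes[of S] by auto
  moreover have "gp_free (sqfree_coprime (\<Prod>S))"
    by (rule gp_free_subset[OF gp_free_squarefree]) (auto simp: sqfree_coprime_def)
  moreover have "\<forall>v\<in>sqfree_coprime (\<Prod>S). v > 0 \<and> coprime v (\<Prod>S)"
    by (auto simp: sqfree_coprime_def intro: Nat.gr0I)
  ultimately show ?case by (intro exI[of _ "sqfree_coprime (\<Prod>S)"] exI[of _ d]) simp
next
  case (insert p P)
  have p: "prime p" "p \<notin> S" using insert by auto
  obtain V d where V: "d \<ge> 1 / 1.64495 * (\<Prod>q\<in>insert p S. real q / (real q + 1)) * (\<Prod>q\<in>P. 1 + 1 / real q ^ 3)"
      "has_asymptotic_density V d" "gp_free V" "\<And>v. v \<in> V \<Longrightarrow> v > 0"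
      "\<And>v. v \<in> V \<Longrightarrow> coprime v (\<Prod>(insert p S))"
    using insert.IH[of "insert p S"] insert.prems insert.hyps by auto
  have cop: "coprime v p" "coprime v (\<Prod>S)" if "v \<in> V" for v
    using V(5)[OF that] insert.prems(1) p by (simp_all add: coprime_mult_right_iff)
  let ?E = "{1, p, p ^ 3, p ^ 4}"
  have copE: "coprime s v" if "s \<in> ?E" "v \<in> V" for s v
    using that(1) cop(1)[OF that(2)] by (auto simp: coprime_commute)
  have "p > 1" using p prime_gt_1_nat by blast
  have "0 \<notin> ?E" using \<open>p > 1\<close> by auto
  have "has_asymptotic_density (mult_set ?E V) (d * (\<Sum>s\<in>?E. 1 / real s))"
    using V(2) copE \<open>0 \<notin> ?E\<close> by (intro density_mult_set inj_on_coprime_mult) auto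
  moreover have "gp_free (mult_set ?E V)"
    using copE gp_free_1_3_4[OF \<open>p > 1\<close>] V(3) by (rule gp_free_mult_set)
  moreover have "\<forall>v\<in>mult_set ?E V. v > 0 \<and> coprime v (\<Prod>S)"
  proof
    fix n assume "n \<in> mult_set ?E V"
    then obtain s v where n: "n = s * v" "s \<in> ?E" "v \<in> V" by (auto simp: mult_set_def)
    have "coprime p (\<Prod>S)"
      using p insert.prems by (intro prod_coprime_right primes_coprime) auto
    then have "coprime s (\<Prod>S)" using n(2) by auto
    with n cop(2) V(4) \<open>0 \<notin> ?E\<close> show "n > 0 \<and> coprime n (\<Prod>S)"
      by (auto simp: coprime_mult_left_iff)
  qed
  moreover have "d * (\<Sum>s\<in>?E. 1 / real s) \<ge> 1 / 1.64495 * (\<Prod>q\<in>S. real q / (real q + 1)) *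
      (\<Prod>q\<in>insert p P. 1 + 1 / real q ^ 3)"
  proof -
    have "p \<noteq> p ^ 3" "p \<noteq> p ^ 4" "p ^ 3 \<noteq> p ^ 4" "1 \<noteq> p ^ 3" "1 \<noteq> p ^ 4"
      using \<open>p > 1\<close> power_inject_exp[of p 1 3] power_inject_exp[of p 1 4] power_inject_exp[of p 3 4]
        power_inject_exp[of p 0 3] power_inject_exp[of p 0 4] by auto
    then have sum: "(\<Sum>s\<in>?E. 1 / real s) = 1 + 1 / real p + 1 / real p ^ 3 + 1 / real p ^ 4"
      using \<open>p > 1\<close> by simp
    \<comment> \<open>Avoiding \<open>p\<close> cost the factor p/(p + 1), which cancels the first
      factor here; the net gain is 1 + 1/p^3.\<close>
    have "1 + 1 / real p + 1 / real p ^ 3 + 1 / real p ^ 4 = (real p + 1) / real p * (1 + 1 / real p ^ 3)"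
      using \<open>p > 1\<close> by (simp add: field_simps power3_eq_cube power4_eq_xxxx)
    then have eq: "real p / (real p + 1) * (1 + 1 / real p + 1 / real p ^ 3 + 1 / real p ^ 4) = 1 + 1 / real p ^ 3"
      using \<open>p > 1\<close> by simp
    have "1 / 1.64495 * (\<Prod>q\<in>S. real q / (real q + 1)) * (\<Prod>q\<in>insert p P. 1 + 1 / real q ^ 3) =
      1 / 1.64495 * (\<Prod>q\<in>insert p S. real q / (real q + 1)) * (\<Prod>q\<in>P. 1 + 1 / real q ^ 3) *
        (1 + 1 / real p + 1 / real p ^ 3 + 1 / real p ^ 4)"
      using insert.hyps insert.prems(1) p(2)
      by (simp only: prod.insert not_False_eq_True) (simp only: mult.assoc mult.commute mult.left_commute flip: eq)
    also have "\<dots> \<le> d * (1 + 1 / real p + 1 / real p ^ 3 + 1 / real p ^ 4)"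
      using V(1) by (intro mult_right_mono) auto
    finally show ?thesis by (simp only: sum)
  qed
  ultimately show ?case by blast
qed

section \<open>An explicit set of integers composed of 2, 3, 5, 7\<close>

text \<open>The 160 numbers were found by a computer search (local optimisation of the sum of reciprocals)
  among the integers composed of the primes 2, 3, 5, 7. Splitting the list only serves to speed up
  membership tests.\<close>

definition smooth_list1 :: "nat list" where
  "smooth_list1 =
    [1, 2, 3, 5, 6, 7, 8, 10, 14, 15, 16, 21, 24, 27, 35, 40, 42, 48, 54, 56, 60, 70,
     80, 81, 90, 105, 112, 120, 125, 135, 150, 162]"

definition smooth_list2 :: "nat list" where
  "smooth_list2 =
    [168, 180, 189, 216, 250, 270, 280, 300, 336, 343, 375, 378, 405, 420, 432, 450,
     480, 512, 560, 567, 625, 630, 648, 686, 750, 840, 875, 900, 945, 1000, 1024, 1029]"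

definition smooth_list3 :: "nat list" where
  "smooth_list3 =
    [1050, 1080, 1134, 1250, 1260, 1296, 1470, 1512, 1536, 1715, 1750, 1875, 1890,
     2000, 2058, 2100, 2401, 2430, 2560, 2625, 2744, 2835, 3000, 3024, 3072, 3150,
     3360, 3375, 3430, 3584, 4096, 4375]"

definition smooth_list4 :: "nat list" where
  "smooth_list4 =
    [4536, 4802, 5000, 5120, 5145, 5250, 5488, 6300, 6750, 7000, 7168, 7203, 7560,
     7680, 8192, 8232, 8750, 9072, 9261, 10000, 10125, 10290, 10752, 11520, 12005,
     12288, 13125, 13720, 13824, 14000, 14406, 16464]"

definition smooth_list5 :: "nat list" where
  "smooth_list5 =
    [16875, 17010, 17280, 17920, 18522, 18750, 19200, 19208, 19683, 20480, 21000,
     21504, 23625, 24010, 24576, 25920, 27000, 27440, 27648, 27783, 28672, 30720,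
     34560, 35000, 35840, 36015, 38416, 38880, 39366, 40960, 41160, 41472]"

definition smooth_list :: "nat list" where
  "smooth_list = smooth_list1 @ smooth_list2 @ smooth_list3 @ smooth_list4 @ smooth_list5"

lemmas smooth_list_defs =
  smooth_list1_def smooth_list2_def smooth_list3_def smooth_list4_def smooth_list5_def

lemma distinct_smooth_list: "distinct smooth_list"
  by (simp add: smooth_list_def smooth_list_defs)

lemma sum_smooth_list: "(\<Sum>s\<in>set smooth_list. 1 / real s) \<ge> 3.2518"
  unfolding sum.distinct_set_conv_list[OF distinct_smooth_list]
  by (simp add: smooth_list_def smooth_list_defs)

lemma smooth_list_bounds: "\<forall>s\<in>set smooth_list. 1 \<le> s \<and> s \<le> 41472"
  by (simp add: smooth_list_def smooth_list_defs)

text \<open>One common multiple of all entries, with prime factors 2, 3, 5, 7 only, reduces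
  coprimality with every entry to coprimality with these four primes.\<close>

lemma smooth_list_dvd: "\<forall>s\<in>set smooth_list. s dvd 2 ^ 13 * 3 ^ 9 * 5 ^ 5 * 7 ^ 4"
  by (simp add: smooth_list_def smooth_list_defs)

section \<open>Checking that the explicit list is progression-free\<close>

text \<open>The five sublists occupy consecutive disjoint ranges, so comparisons select the only one
  that can contain \<open>n\<close>.\<close>

lemma in_smooth_list_iff:
  "n \<in> set smooth_list \<longleftrightarrow>
    (if n < 168 then n \<in> set smooth_list1
     else if n < 1050 then n \<in> set smooth_list2
     else if n < 4536 then n \<in> set smooth_list3
     else if n < 16875 then n \<in> set smooth_list4
     else n \<in> set smooth_list5)"
proof -
  have "\<forall>s\<in>set smooth_list1. s < 168" "\<forall>s\<in>set smooth_list2. 168 \<le> s \<and> s < 1050"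
    "\<forall>s\<in>set smooth_list3. 1050 \<le> s \<and> s < 4536" "\<forall>s\<in>set smooth_list4. 4536 \<le> s \<and> s < 16875"
    "\<forall>s\<in>set smooth_list5. 16875 \<le> s"
    by (simp_all add: smooth_list_defs)
  then have "n \<in> set smooth_list1 \<Longrightarrow> n < 168" "n \<in> set smooth_list2 \<Longrightarrow> 168 \<le> n \<and> n < 1050"
    "n \<in> set smooth_list3 \<Longrightarrow> 1050 \<le> n \<and> n < 4536" "n \<in> set smooth_list4 \<Longrightarrow> 4536 \<le> n \<and> n < 16875"
    "n \<in> set smooth_list5 \<Longrightarrow> 16875 \<le> n"
    by blast+
  then show ?thesis unfolding smooth_list_def set_append Un_iff by auto
qed

lemma in_set_Cons_if: "n \<in> set (x # xs) \<longleftrightarrow> (if n = x then True else n \<in> set xs)"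
  by simp

lemmas in_smooth_lists_iff =
  smooth_list_defs[THEN arg_cong[where f = "\<lambda>xs. n \<in> set xs" for n],
    unfolded in_set_Cons_if list.set(1) empty_iff]

text \<open>The recursion below is phrased with nested conditionals only, so that the simplifier evaluates
  it lazily.\<close>

definition no_progression_from :: "nat \<Rightarrow> nat \<Rightarrow> bool" where
  "no_progression_from s n \<longleftrightarrow>
    (\<forall>k\<ge>n. s * k \<in> set smooth_list \<longrightarrow> s * k * k \<notin> set smooth_list)"

text \<open>Since 41472 bounds the entries, no ratio from \<open>n\<close> on can give a third term
  once \<open>s * n * n\<close> exceeds it; this ends the recursion.\<close>

lemma no_progression_from_rec:
  assumes "s > 0"
  shows "no_progression_from s n \<longleftrightarrow>
    (if 41472 < s * n * n then True
     else if s * n \<in> set smooth_list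
       then (if s * n * n \<in> set smooth_list then False else no_progression_from s (n + 1))
     else no_progression_from s (n + 1))"
proof (cases "41472 < s * n * n")
  case True
  have "s * k * k \<notin> set smooth_list" if "k \<ge> n" for k
  proof -
    have "s * n * n \<le> s * k * k" using that by (intro mult_mono) auto
    with True smooth_list_bounds show ?thesis by fastforce
  qed
  with True show ?thesis by (simp add: no_progression_from_def)
next
  case False
  have split: "(\<forall>k\<ge>n. P k) \<longleftrightarrow> P n \<and> (\<forall>k\<ge>n + 1. P k)" for P
    using le_eq_less_or_eq[of n] by (auto simp: Suc_le_eq)
  show ?thesis using False by (subst no_progression_from_def, subst split) (auto simp: no_progression_from_def)
qed

lemma no_progression_smooth_list: "\<forall>s\<in>set smooth_list. no_progression_from s 2"
  unfolding smooth_list_def smooth_list_defs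
  \<comment> \<open>Without \<open>One_nat_def\<close>, 1 is not turned into \<open>Suc 0\<close>,
    and the ratios and products are computed as numerals.\<close>
  by (simp del: One_nat_def add: no_progression_from_rec in_smooth_list_iff in_smooth_lists_iff)

lemma gp_free_smooth_list: "gp_free (set smooth_list)"
  unfolding gp_free_def
proof (intro ballI impI)
  fix x y z assume xyz: "x \<in> set smooth_list" "y \<in> set smooth_list" "z \<in> set smooth_list"
    and "x dvd y" and eq: "y * y = x * z"
  then obtain k where k: "y = x * k" by auto
  have pos: "x > 0" "y > 0" using xyz smooth_list_bounds by fastforce+
  with eq k have "z = x * k * k" by (simp add: ac_simps)
  with xyz k no_progression_smooth_list have "\<not> k \<ge> 2"
    unfolding no_progression_from_def by blast
  with k pos have "k = 1" by (cases k) auto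
  with k show "x = y" by simp
qed

section \<open>Combining the factors and the final numerical estimate\<close>

lemma gp_free_with_large_density:
  "\<exists>A d. A \<subseteq> {1..} \<and> has_asymptotic_density A d \<and> d > 0.72195 \<and> gp_free A"
proof -
  \<comment> \<open>The primes in \<open>?S\<close> are left to the explicit list, those in
    \<open>?P\<close> get exponents 0, 1, 3, 4, and all larger primes keep exponents 0, 1.\<close>
  let ?S = "{2, 3, 5, 7} :: nat set" and ?P = "{11, 13, 17, 19, 23, 29, 31} :: nat set"
  have "prime p" if "p \<in> ?S \<union> ?P" for p
    using that by auto
  then obtain V d where V: "d \<ge> 1 / 1.64495 * (\<Prod>p\<in>?S. real p / (real p + 1)) * (\<Prod>p\<in>?P. 1 + 1 / real p ^ 3)"
      "has_asymptotic_density V d" "gp_free V" "\<And>v. v \<in> V \<Longrightarrow> v > 0" "\<And>v. v \<in> V \<Longrightarrow> coprime v (\<Prod>?S)"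
    using density_gp_free_coprime[of ?P ?S] by auto
  have cop: "coprime s v" if "s \<in> set smooth_list" "v \<in> V" for s v
  proof -
    have "coprime v q" if "q dvd \<Prod>?S" for q
      using V(5)[OF \<open>v \<in> V\<close>] coprime_divisors[OF dvd_refl that, of v] by simp
    from this[of 2] this[of 3] this[of 5] this[of 7]
    have "coprime v (2 ^ 13 * 3 ^ 9 * 5 ^ 5 * 7 ^ 4)"
      by (simp add: coprime_mult_right_iff del: power_numeral)
    moreover have "s dvd 2 ^ 13 * 3 ^ 9 * 5 ^ 5 * 7 ^ 4" using smooth_list_dvd that(1) by blast
    ultimately have "coprime v s" by (rule coprime_divisors[OF dvd_refl, rotated])
    then show ?thesis unfolding coprime_commute[of s v] .
  qed
  have "0 \<notin> set smooth_list" using smooth_list_bounds not_one_le_zero by blast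
  let ?A = "mult_set (set smooth_list) V"
  have "has_asymptotic_density ?A (d * (\<Sum>s\<in>set smooth_list. 1 / real s))"
    using V(2) cop \<open>0 \<notin> set smooth_list\<close> by (intro density_mult_set inj_on_coprime_mult) auto
  moreover have "gp_free ?A"
    using cop gp_free_smooth_list V(3) by (rule gp_free_mult_set)
  moreover have "?A \<subseteq> {1..}"
  proof
    fix n assume "n \<in> ?A"
    then obtain s v where n: "n = s * v" "s \<in> set smooth_list" "v \<in> V" by (auto simp: mult_set_def)
    have "s > 0" using n(2) \<open>0 \<notin> set smooth_list\<close> by (metis gr0I)
    with n V(4) show "n \<in> {1..}" by (simp add: Suc_le_eq)
  qed
  moreover have "d * (\<Sum>s\<in>set smooth_list. 1 / real s) > 0.72195"
  proof -
    \<comment> \<open>A tight rational comparison: multiplied by 3.2518, the left side exceeds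
      0.72195 by less than 10^-5.\<close>
    have "1 / 1.64495 * (\<Prod>p\<in>?S. real p / (real p + 1)) * (\<Prod>p\<in>?P. 1 + 1 / real p ^ 3) > 0.72195 / (3.2518 :: real)"
      by simp
    with V(1) have d: "d > 0.72195 / 3.2518" by (rule order.strict_trans2[rotated])
    then have "0.72195 < d * 3.2518" by simp
    also have "\<dots> \<le> d * (\<Sum>s\<in>set smooth_list. 1 / real s)"
      using sum_smooth_list d by (intro mult_left_mono) auto
    finally show ?thesis .
  qed
  ultimately show ?thesis by blast
qed

theorem theorem3p2:
  shows "\<beta> > 0.72195 \<and>
    (\<exists>A d. A \<subseteq> {1..} \<and> has_asymptotic_density A d \<and> d > 0.72195 \<and> \<not> has_int_ratio_gp3 A)"
proof -
  obtain A d where A: "A \<subseteq> {1..}" "has_asymptotic_density A d" "d > 0.72195" "\<not> has_int_ratio_gp3 A"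
    using gp_free_with_large_density gp_free_imp_no_int_ratio_gp3 by blast
  have "d \<le> \<beta>" unfolding \<beta>_def
  \<comment> \<open>Densities are at most 1, so the set is bounded above and \<open>Sup\<close> is a
    genuine upper bound.\<close>
  proof (rule cSup_upper)
    show "d \<in> {d. \<exists>A\<subseteq>{1..}. \<not> has_int_ratio_gp3 A \<and> has_asymptotic_density A d}" using A by blast
    show "bdd_above {d. \<exists>A\<subseteq>{1..}. \<not> has_int_ratio_gp3 A \<and> has_asymptotic_density A d}"
      by (rule bdd_aboveI[of _ 1]) (use density_le_one in blast)
  qed
  with A(3) have "\<beta> > 0.72195" by linarith
  with A show ?thesis by blast
qed

end
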